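(* Let $G$ be a threshold graph on $n$ vertices with binary sequence $\mathbf{b}=\mathbf{0}^{s_1}\mathbf{1}^{t_1}\cdots\mathbf{0}^{s_r}\mathbf{1}^{t_r}$, where $s_j,t_j$ are positive integers with $\sum_{j=1}^r(s_j+t_j)=n$. Then $G$ is simply structured if and only if $$1\leq r\leq \left\lfloor \frac{\lfloor \log_2(n)\rfloor+1}{2}\right\rfloor,$$ for each $i=1,\ldots,r$, $$\left\lceil \frac{n-\sum_{j=i+1}^r(s_j+t_j)}{2}\right\rceil \leq t_i\leq n-\sum_{j=i+1}^r(s_j+t_j)-2^{2i-2},$$ and for each $i=2,\ldots,r$, $$\left\lceil \frac{n-t_i-\sum_{j=i+1}^r(s_j+t_j)}{2}\right\rceil \leq s_i\leq n-t_i-\sum_{j=i+1}^r(s_j+t_j)-2^{2i-3},$$ with $s_1=n-t_1-\sum_{j=2}^r(s_j+t_j)$.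
   Context: Threshold graph: given a sequence $\mathbf{b}=(b_1,\ldots,b_n)$ of 0's and 1's with $b_1=0$, the associated threshold graph has vertices $1,\ldots,n$ added in order; when vertex $i$ is added, it is isolated if $b_i=0$, and it is joined to all vertices $j<i$ if $b_i=1$. The notation $\mathbf{0}^{s_1}\mathbf{1}^{t_1}\cdots\mathbf{0}^{s_r}\mathbf{1}^{t_r}$ denotes $s_1$ zeros, then $t_1$ ones, then $s_2$ zeros, etc. A graph $G$ is simply structured if its Laplacian matrix $L(G)=D(G)-A(G)$ has an eigenbasis (basis of $\mathbb{R}^n$ consisting of eigenvectors) whose vectors all have entries in $\{-1,0,1\}$. Empty sums are $0$. *)

theory Defs
  imports
    Complex_Main
    "Jordan_Normal_Form.VS_Connect"
    "Jordan_Normal_Form.Char_Poly"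
begin

text \<open>
  A simple graph on \<open>n\<close> vertices has vertex set \<open>{0..<n}\<close> and is given by its set of edges,
  each a two-element set of vertices.
\<close>

definition simple_graph :: "nat \<Rightarrow> nat set set \<Rightarrow> bool" where
  "simple_graph n E \<longleftrightarrow> (\<forall>e\<in>E. e \<subseteq> {0..<n} \<and> card e = 2)"

definition degree_matrix :: "nat \<Rightarrow> nat set set \<Rightarrow> real mat" where
  "degree_matrix n E = mat_diag n (\<lambda>i. real (card {e \<in> E. i \<in> e}))"

definition adjacency_matrix :: "nat \<Rightarrow> nat set set \<Rightarrow> real mat" where
  "adjacency_matrix n E = mat n n (\<lambda>(i, j). if {i, j} \<in> E then 1 else 0)"

definition laplacian :: "nat \<Rightarrow> nat set set \<Rightarrow> real mat" where
  "laplacian n E = degree_matrix n E - adjacency_matrix n E"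

definition simply_structured :: "nat \<Rightarrow> nat set set \<Rightarrow> bool" where
  "simply_structured n E \<longleftrightarrow>
    (\<exists>B. vectorspace.basis class_ring (module_vec TYPE(real) n) B \<and>
      (\<forall>v\<in>B. (\<exists>k. eigenvector (laplacian n E) v k) \<and> (\<forall>i<n. v $ i \<in> {-1, 0, 1})))"

text \<open>
  A binary sequence is a list of booleans, \<open>True\<close> standing for 1. Positions and vertices are counted
  from 0, so the vertex and bit numbered \<open>i\<close> here are the ones numbered \<open>i + 1\<close> when counting
  from 1.
\<close>

definition threshold_sequence :: "bool list \<Rightarrow> bool" where
  "threshold_sequence b \<longleftrightarrow> b \<noteq> [] \<and> \<not> b ! 0"

definition threshold_edges :: "bool list \<Rightarrow> nat set set" where
  "threshold_edges b = {{j, i} |i j. i < length b \<and> j < i \<and> b ! i}"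

lemma simple_graph_threshold: "simple_graph (length b) (threshold_edges b)"
  by (auto simp: simple_graph_def threshold_edges_def)

text \<open>The blocks are indexed from 1, so \<open>s 0\<close> and \<open>t 0\<close> are irrelevant.\<close>

definition block_sequence :: "nat \<Rightarrow> (nat \<Rightarrow> nat) \<Rightarrow> (nat \<Rightarrow> nat) \<Rightarrow> bool list" where
  "block_sequence r s t =
    concat (map (\<lambda>j. replicate (s j) False @ replicate (t j) True) [1..<Suc r])"

end

theory Submission
  imports Defs
begin

text \<open>
  Cut the vertices into the maximal blocks of equal bits. Each block except possibly the first
  contributes one eigenvalue, distinct from all others, whose eigenvectors are the vectors with
  sum 0 that are constant before the block and vanish after it. Such a vector with entries in
  \<open>{-1, 0, 1}\<close> that does not vanish before the block needs a block at least as long as everything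
  before it; conversely, this length suffices for a basis. So simply structured means that every
  block at least doubles the number of vertices, which is what the lower bounds say. The bound on
  \<open>r\<close> and the upper bounds then follow, as the \<open>k\<close>-th partial sum is at least \<open>2\<^sup>k\<^sup>-\<^sup>1\<close>.
\<close>

section \<open>The Laplacian of a threshold graph\<close>

lemma edge_in_threshold_edges_iff:
  "{i, j} \<in> threshold_edges b \<longleftrightarrow> i \<noteq> j \<and> i < length b \<and> j < length b \<and> b ! max i j"
proof
  assume "{i, j} \<in> threshold_edges b"
  then obtain i' j' where *: "{i, j} = {j', i'}" "i' < length b" "j' < i'" "b ! i'"
    by (auto simp: threshold_edges_def)
  then show "i \<noteq> j \<and> i < length b \<and> j < length b \<and> b ! max i j"
    by (auto simp: doubleton_eq_iff max_def)
next
  assume *: "i \<noteq> j \<and> i < length b \<and> j < length b \<and> b ! max i j"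
  have edge: "{j', i'} \<in> threshold_edges b" if "j' < i'" "i' < length b" "b ! i'" for i' j'
    using that by (auto simp: threshold_edges_def)
  show "{i, j} \<in> threshold_edges b"
    using * edge[of i j] edge[of j i] by (cases "i < j") (auto simp: max_def insert_commute)
qed

text \<open>Sending a neighbour \<open>j\<close> of \<open>i\<close> to the edge
  \<open>{i, j}\<close> is a bijection, so the degree becomes a row sum of the adjacency
  matrix.\<close>

lemma card_incident_edges:
  assumes "simple_graph n E" "i < n"
  shows "card {e \<in> E. i \<in> e} = card {j \<in> {..<n}. {i, j} \<in> E}"
proof (rule sym, rule bij_betw_same_card)
  have "inj_on (\<lambda>j. {i, j}) {j \<in> {..<n}. {i, j} \<in> E}"
    by (auto simp: inj_on_def doubleton_eq_iff)
  moreover have "e \<in> (\<lambda>j. {i, j}) ` {j \<in> {..<n}. {i, j} \<in> E}" if e: "e \<in> E" "i \<in> e" for e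
  proof -
    have "card e = 2" "e \<subseteq> {0..<n}" using assms(1) e by (auto simp: simple_graph_def)
    then obtain j where "e = {i, j}" using e(2)
      by (metis card_2_iff insert_commute insertE singletonD)
    then show ?thesis using e \<open>e \<subseteq> {0..<n}\<close> by auto
  qed
  ultimately show "bij_betw (\<lambda>j. {i, j}) {j \<in> {..<n}. {i, j} \<in> E} {e \<in> E. i \<in> e}"
    by (auto simp: bij_betw_def)
qed

lemma laplacian_carrier [simp]: "laplacian n E \<in> carrier_mat n n"
  by (auto simp: laplacian_def degree_matrix_def adjacency_matrix_def)

lemma laplacian_dim [simp]: "dim_row (laplacian n E) = n" "dim_col (laplacian n E) = n"
  using carrier_matD[OF laplacian_carrier] by auto

lemma transpose_laplacian: "(laplacian n E)\<^sup>T = laplacian n E"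
  by (rule eq_matI)
    (auto simp: laplacian_def degree_matrix_def adjacency_matrix_def mat_diag_def insert_commute)

lemma laplacian_mult_vec:
  assumes "simple_graph n E" "i < n"
  shows "(laplacian n E *\<^sub>v vec n x) $ i = (\<Sum>j<n. if {i, j} \<in> E then x i - x j else 0)"
proof -
  define d where "d = real (card {e \<in> E. i \<in> e})"
  have d: "d = (\<Sum>j<n. if {i, j} \<in> E then 1 else 0)"
    unfolding d_def card_incident_edges[OF assms]
    by (simp add: sum.If_cases Int_def)
  have "(laplacian n E *\<^sub>v vec n x) $ i =
      (\<Sum>j<n. ((if i = j then d else 0) - (if {i, j} \<in> E then 1 else 0)) * x j)"
    using assms(2)
    by (auto simp: laplacian_def degree_matrix_def adjacency_matrix_def mat_diag_def d_def
        scalar_prod_def atLeast0LessThan intro!: sum.cong)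
  also have "\<dots> = (\<Sum>j<n. (if j = i then d * x i else 0) - (if {i, j} \<in> E then x j else 0))"
    by (intro sum.cong) (auto simp: algebra_simps)
  also have "\<dots> = d * x i - (\<Sum>j<n. if {i, j} \<in> E then x j else 0)"
    using assms(2) by (simp add: sum_subtractf)
  also have "\<dots> = (\<Sum>j<n. if {i, j} \<in> E then x i - x j else 0)"
    unfolding d sum_distrib_right sum_subtractf[symmetric] by (intro sum.cong) auto
  finally show ?thesis .
qed

text \<open>The later of two vertices decides on their adjacency: \<open>b ! i\<close> does so for
  \<open>j < i\<close>, and \<open>b ! j\<close> for \<open>j > i\<close>.\<close>

lemma threshold_laplacian_mult_vec:
  assumes "i < length b"
  shows "(laplacian (length b) (threshold_edges b) *\<^sub>v vec (length b) x) $ i =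
    (\<Sum>j<i. if b ! i then x i - x j else 0) +
    (\<Sum>j=Suc i..<length b. if b ! j then x i - x j else 0)"
proof -
  let ?g = "\<lambda>j. if {i, j} \<in> threshold_edges b then x i - x j else 0"
  have split: "{..<length b} = {..<i} \<union> {i} \<union> {Suc i..<length b}" using assms by auto
  have "(\<Sum>j<length b. ?g j) = (\<Sum>j<i. ?g j) + (\<Sum>j=Suc i..<length b. ?g j)"
    unfolding split by (subst sum.union_disjoint) auto
  also have "(\<Sum>j<i. ?g j) = (\<Sum>j<i. if b ! i then x i - x j else 0)"
    using assms by (intro sum.cong) (auto simp: edge_in_threshold_edges_iff max_def)
  also have "(\<Sum>j=Suc i..<length b. ?g j) =
      (\<Sum>j=Suc i..<length b. if b ! j then x i - x j else 0)"
    using assms by (intro sum.cong) (auto simp: edge_in_threshold_edges_iff max_def)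
  finally show ?thesis
    using laplacian_mult_vec[OF simple_graph_threshold assms] by simp
qed

text \<open>Moving the symmetric \<open>A\<close> across the bilinear product gives
  \<open>k * (v \<bullet> w) = l * (v \<bullet> w)\<close>.\<close>

lemma eigenvectors_orthogonal:
  fixes A :: "'a :: field mat"
  assumes A: "A \<in> carrier_mat n n" "A\<^sup>T = A"
    and v: "v \<in> carrier_vec n" "A *\<^sub>v v = k \<cdot>\<^sub>v v"
    and w: "w \<in> carrier_vec n" "A *\<^sub>v w = l \<cdot>\<^sub>v w"
    and "k \<noteq> l"
  shows "v \<bullet> w = 0"
proof -
  have "k * (v \<bullet> w) = (A *\<^sub>v v) \<bullet> w" using v w by simp
  also have "\<dots> = v \<bullet> (A *\<^sub>v w)"
    using transpose_vec_mult_scalar[OF A(1) w(1) v(1)] A(2) by simp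
  also have "\<dots> = l * (v \<bullet> w)" using v w by simp
  finally show ?thesis using \<open>k \<noteq> l\<close> by simp
qed

section \<open>Eigenvectors supported on initial blocks\<close>

text \<open>The blocks are counted from 0 and the \<open>k\<close>-th one occupies the positions
  \<open>S k, \<dots>, S (Suc k) - 1\<close>.\<close>

locale alternating_blocks =
  fixes b :: "bool list" and S :: "nat \<Rightarrow> nat" and K :: nat
  assumes S_0 [simp]: "S 0 = 0"
    and S_less_Suc: "k < K \<Longrightarrow> S k < S (Suc k)"
    and S_K: "S K = length b"
    and bit: "k < K \<Longrightarrow> S k \<le> i \<Longrightarrow> i < S (Suc k) \<Longrightarrow> b ! i \<longleftrightarrow> odd k"
    and even_K: "even K"
begin

abbreviation n where "n \<equiv> length b"
abbreviation L where "L \<equiv> laplacian n (threshold_edges b)"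

section \<open>The eigenvalues of the blocks\<close>

definition ones :: "nat \<Rightarrow> real" where
  "ones a = (\<Sum>j=a..<n. if b ! j then 1 else 0)"

text \<open>Take a vertex of block \<open>k\<close> and a vector as in
  \<open>block_eigenvector\<close>. Later vertices with bit 1 are neighbours with entry 0, whence
  the first summand. In a block of ones the vertex is also joined to all others among the first
  \<open>S (Suc k)\<close>, over which the entries sum to 0, whence the second.\<close>

definition block_eigenvalue :: "nat \<Rightarrow> real" where
  "block_eigenvalue k = ones (S (Suc k)) + (if odd k then real (S (Suc k)) else 0)"

lemma S_mono: "k \<le> l \<Longrightarrow> l \<le> K \<Longrightarrow> S k \<le> S l"
proof (induction rule: dec_induct)
  case (step m)
  then show ?case using S_less_Suc[of m] by simp
qed simp

lemma S_le: "k \<le> K \<Longrightarrow> S k \<le> n"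
  using S_mono[of k K] S_K by simp

lemma ex_block:
  assumes "i < n"
  obtains k where "k < K" "S k \<le> i" "i < S (Suc k)"
proof -
  have "\<exists>k<m. S k \<le> i \<and> i < S (Suc k)" if "i < S m" "m \<le> K" for m
    using that
  proof (induction m)
    case (Suc m)
    then show ?case by (cases "i < S m") (auto intro: less_SucI simp: not_less)
  qed simp
  from this[of K] show ?thesis using that assms S_K by auto
qed

lemma ones_Suc: "a < n \<Longrightarrow> ones a = (if b ! a then 1 else 0) + ones (Suc a)"
  unfolding ones_def by (simp add: sum.atLeast_Suc_lessThan)

lemma ones_bounds:
  assumes "a \<le> c" "c \<le> n"
  shows "ones c \<le> ones a" "ones a \<le> real c - real a + ones c"
proof -
  have split: "ones a = (\<Sum>j=a..<c. if b ! j then 1 else 0) + ones c"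
    unfolding ones_def using assms by (simp add: sum.atLeastLessThan_concat)
  show "ones c \<le> ones a" unfolding split by (simp add: sum_nonneg)
  have "(\<Sum>j=a..<c. if b ! j then 1 else 0 :: real) \<le> real (card {a..<c}) * 1"
    by (rule sum_bounded_above) auto
  then show "ones a \<le> real c - real a + ones c"
    unfolding split using assms by (simp add: of_nat_diff)
qed

lemma ones_nonneg: "ones a \<ge> 0"
  unfolding ones_def by (simp add: sum_nonneg)

text \<open>The eigenvalues decrease along the blocks of zeros, increase along the blocks of ones,
  and the latter exceed the former. For equal parities, strictness comes from position
  \<open>S (Suc k)\<close>, whose bit is opposite to that of block \<open>k\<close>.\<close>

lemma block_eigenvalue_neq_if_less:
  assumes "k < l" "l < K"
  shows "block_eigenvalue k \<noteq> block_eigenvalue l"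
proof -
  let ?p = "S (Suc k)" and ?q = "S (Suc l)"
  have p: "?p < S (Suc (Suc k))" "0 < ?p" using S_less_Suc[of "Suc k"] S_less_Suc[of k] assms by auto
  have pq: "Suc ?p \<le> ?q" using p(1) S_mono[of "Suc (Suc k)" "Suc l"] assms by simp
  have q: "?q \<le> n" using S_le[of "Suc l"] assms by simp
  have bp: "b ! ?p \<longleftrightarrow> even k" using bit[of "Suc k" ?p] p assms by simp
  have eq: "ones ?p = (if even k then 1 else 0) + ones (Suc ?p)"
    using ones_Suc[of ?p] bp pq q by simp
  note bounds = ones_bounds[OF pq q] ones_bounds[OF _ q, of ?p]
  show ?thesis
    using bounds eq p pq unfolding block_eigenvalue_def by (cases "even k"; cases "even l") auto
qed

lemma block_eigenvalue_inj:
  "k < K \<Longrightarrow> l < K \<Longrightarrow> k \<noteq> l \<Longrightarrow> block_eigenvalue k \<noteq> block_eigenvalue l"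
  using block_eigenvalue_neq_if_less[of k l] block_eigenvalue_neq_if_less[of l k] by force

text \<open>A block of zeros is followed by a block of ones, as \<open>K\<close> is even; for a
  block of ones the second summand is positive. This separates the eigenvalue from that of the
  all-ones vector.\<close>

lemma block_eigenvalue_nonzero:
  assumes "k < K"
  shows "block_eigenvalue k \<noteq> 0"
proof (cases "even k")
  case True
  then have k: "Suc k < K" using assms even_K by (metis Suc_lessI even_Suc)
  have "b ! S (Suc k)" using bit[OF k] S_less_Suc[OF k] True by simp
  moreover have "S (Suc k) < n" using S_less_Suc[OF k] S_le[of "Suc (Suc k)"] k by simp
  ultimately have "ones (S (Suc k)) \<ge> 1"
    using ones_Suc ones_nonneg[of "Suc (S (Suc k))"] by simp
  then show ?thesis using True by (simp add: block_eigenvalue_def)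
next
  case False
  then show ?thesis
    using S_less_Suc[OF assms] ones_nonneg[of "S (Suc k)"] by (simp add: block_eigenvalue_def)
qed

lemma block_eigenvector:
  assumes k: "k < K"
    and const: "\<And>i. i < S k \<Longrightarrow> x i = c"
    and zero: "\<And>i. S (Suc k) \<le> i \<Longrightarrow> x i = 0"
    and sum_zero: "(\<Sum>i<S (Suc k). x i) = 0"
  shows "L *\<^sub>v vec n x = block_eigenvalue k \<cdot>\<^sub>v vec n x"
proof (rule eq_vecI)
  fix i assume "i < dim_vec (block_eigenvalue k \<cdot>\<^sub>v vec n x)"
  then have i: "i < n" by simp
  let ?p = "S k" and ?q = "S (Suc k)" and ?\<beta> = "if odd k then 1 else 0 :: real"
  have pq: "?p < ?q" "?q \<le> n" using S_less_Suc[OF k] S_le[of "Suc k"] k by auto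
  have total: "c * real ?p + (\<Sum>j=?p..<?q. x j) = 0"
  proof -
    have "(\<Sum>j<?q. x j) = (\<Sum>j<?p. x j) + (\<Sum>j=?p..<?q. x j)"
      using pq sum.atLeastLessThan_concat[of 0 ?p ?q x] by (simp add: atLeast0LessThan)
    then show ?thesis using const sum_zero by (simp add: mult.commute)
  qed
  have after: "(\<Sum>j=?q..<n. if b ! j then x i - x j else 0) = ones ?q * x i"
    unfolding ones_def sum_distrib_right using zero by (intro sum.cong) auto
  have "(\<Sum>j<i. if b ! i then x i - x j else 0) +
    (\<Sum>j=Suc i..<n. if b ! j then x i - x j else 0) = block_eigenvalue k * x i"
  proof -
    consider "i < ?p" | "?p \<le> i" "i < ?q" | "?q \<le> i" by linarith
    then show ?thesis
    proof cases
      \<comment> \<open>Differences within the constant part vanish; by \<open>total\<close>, a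
        block of ones contributes \<open>real ?q * c\<close>.\<close>
      case 1
      have before: "(\<Sum>j<i. if b ! i then x i - x j else 0) = 0"
        using const 1 by (intro sum.neutral) auto
      have "(\<Sum>j=Suc i..<n. if b ! j then x i - x j else 0) =
          (\<Sum>j=Suc i..<?p. if b ! j then x i - x j else 0) +
          (\<Sum>j=?p..<?q. if b ! j then x i - x j else 0) +
          (\<Sum>j=?q..<n. if b ! j then x i - x j else 0)"
        using 1 pq by (simp add: sum.atLeastLessThan_concat)
      also have "(\<Sum>j=Suc i..<?p. if b ! j then x i - x j else 0) = 0"
        using const 1 by (intro sum.neutral) auto
      also have "(\<Sum>j=?p..<?q. if b ! j then x i - x j else 0) = (\<Sum>j=?p..<?q. ?\<beta> * (c - x j))"
        using const[OF 1] bit[OF k] by (intro sum.cong) auto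
      also have "\<dots> = ?\<beta> * (real (?q - ?p) * c - (\<Sum>j=?p..<?q. x j))"
        by (simp add: sum_distrib_left[symmetric] sum_subtractf)
      also have "\<dots> = ?\<beta> * real ?q * c"
        using total pq by (auto simp: algebra_simps of_nat_diff)
      also note after
      finally show ?thesis
        using const 1 before by (auto simp: block_eigenvalue_def algebra_simps)
    next
      \<comment> \<open>In a block of ones, \<open>i\<close> is joined to all other positions below
        \<open>?q\<close>; as all entries there sum to 0, they contribute
        \<open>real ?q * x i\<close>.\<close>
      case 2
      have bi: "b ! i \<longleftrightarrow> odd k" using bit[OF k] 2 by simp
      have all: "(\<Sum>j<i. x j) + x i + (\<Sum>j=Suc i..<?q. x j) = 0"
      proof -
        have "(\<Sum>j<?q. x j) = (\<Sum>j<Suc i. x j) + (\<Sum>j=Suc i..<?q. x j)"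
          using 2 sum.atLeastLessThan_concat[of 0 "Suc i" ?q x] by (simp add: atLeast0LessThan)
        then show ?thesis using sum_zero by simp
      qed
      have "(\<Sum>j=Suc i..<n. if b ! j then x i - x j else 0) =
          (\<Sum>j=Suc i..<?q. if b ! j then x i - x j else 0) +
          (\<Sum>j=?q..<n. if b ! j then x i - x j else 0)"
        using 2 pq by (simp add: sum.atLeastLessThan_concat)
      also have "(\<Sum>j=Suc i..<?q. if b ! j then x i - x j else 0) =
          (\<Sum>j=Suc i..<?q. ?\<beta> * (x i - x j))"
        using bit[OF k] 2 by (intro sum.cong) auto
      also have "\<dots> = ?\<beta> * (real (?q - Suc i) * x i - (\<Sum>j=Suc i..<?q. x j))"
        by (simp add: sum_distrib_left[symmetric] sum_subtractf)
      also note after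
      finally have "(\<Sum>j<i. if b ! i then x i - x j else 0) +
          (\<Sum>j=Suc i..<n. if b ! j then x i - x j else 0) =
          ?\<beta> * (real i * x i - (\<Sum>j<i. x j) + real (?q - Suc i) * x i - (\<Sum>j=Suc i..<?q. x j))
          + ones ?q * x i"
        using bi by (auto simp: sum_subtractf algebra_simps)
      also have "real i * x i - (\<Sum>j<i. x j) + real (?q - Suc i) * x i - (\<Sum>j=Suc i..<?q. x j)
          = real ?q * x i"
        using all 2 by (simp add: algebra_simps of_nat_diff)
      finally show ?thesis by (simp add: block_eigenvalue_def algebra_simps)
    next
      \<comment> \<open>Here \<open>x i = 0\<close>, and \<open>i\<close> is joined to all earlier
        positions or to none; their entries sum to 0.\<close>
      case 3
      have "(\<Sum>j<i. x j) = (\<Sum>j<?q. x j) + (\<Sum>j=?q..<i. x j)"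
        using 3 sum.atLeastLessThan_concat[of 0 ?q i x] by (simp add: atLeast0LessThan)
      then have "(\<Sum>j<i. if b ! i then x i - x j else 0) = 0"
        using sum_zero zero 3 by (cases "b ! i") (simp_all add: sum_negf)
      moreover have "(\<Sum>j=Suc i..<n. if b ! j then x i - x j else 0) = 0"
        using zero 3 by (intro sum.neutral) auto
      ultimately show ?thesis using zero 3 by simp
    qed
  qed
  then show "(L *\<^sub>v vec n x) $ i = (block_eigenvalue k \<cdot>\<^sub>v vec n x) $ i"
    using threshold_laplacian_mult_vec[OF i] i by simp
qed simp

lemma const_eigenvector: "L *\<^sub>v vec n (\<lambda>_. 1) = 0 \<cdot>\<^sub>v vec n (\<lambda>_. 1)"
proof (rule eq_vecI)
  fix i assume "i < dim_vec (0 \<cdot>\<^sub>v vec n (\<lambda>_. 1 :: real))"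
  then have "i < n" by simp
  then show "(L *\<^sub>v vec n (\<lambda>_. 1)) $ i = (0 \<cdot>\<^sub>v vec n (\<lambda>_. 1)) $ i"
    by (subst threshold_laplacian_mult_vec) (auto intro!: sum.neutral)
qed simp

text \<open>These are test vectors: an eigenvector for another eigenvalue is orthogonal to them,
  which by \<open>scalar_prod_position\<close> means that its entry at \<open>j > 0\<close> is the
  mean of the entries before it. For \<open>j = 0\<close> the vector is zero.\<close>

lemma position_eigenvector:
  assumes k: "k < K" "S k \<le> j" "j < S (Suc k)"
  defines "x \<equiv> \<lambda>i. if i < j then 1 else if i = j then - real j else 0"
  shows "L *\<^sub>v vec n x = block_eigenvalue k \<cdot>\<^sub>v vec n x"
proof (rule block_eigenvector[OF k(1)])
  have "(\<Sum>i<S (Suc k). x i) = (\<Sum>i<Suc j. x i)"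
    using k by (intro sum.mono_neutral_right) (auto simp: x_def)
  then show "(\<Sum>i<S (Suc k). x i) = 0" by (simp add: x_def)
qed (use k in \<open>auto simp: x_def\<close>)

lemma scalar_prod_position:
  assumes "j < n" "v \<in> carrier_vec n"
  shows "v \<bullet> vec n (\<lambda>i. if i < j then 1 else if i = j then - real j else 0) =
    (\<Sum>i<j. v $ i) - real j * v $ j"
proof -
  have "v \<bullet> vec n (\<lambda>i. if i < j then 1 else if i = j then - real j else 0) =
      (\<Sum>i<n. v $ i * (if i < j then 1 else if i = j then - real j else 0))"
    using assms by (simp add: scalar_prod_def atLeast0LessThan)
  also have "\<dots> = (\<Sum>i<Suc j. v $ i * (if i < j then 1 else if i = j then - real j else 0))"
    using assms by (intro sum.mono_neutral_right) auto
  finally show ?thesis by simp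
qed

section \<open>Simply structured implies doubling\<close>

text \<open>The eigenvector \<open>u\<close> below is constant on the \<open>k\<close>-th block as well. Some basis vector \<open>v\<close> is
  not orthogonal to it, and this forces \<open>v $ 0 \<noteq> 0\<close>.\<close>

lemma doubling_if_simply_structured:
  assumes ss: "simply_structured n (threshold_edges b)" and k: "k < K"
  shows "2 * S k \<le> S (Suc k)"
proof (cases "S k = 0")
  case p0: False
  interpret V: vec_space "TYPE(real)" n .
  define p q where "p = S k" and "q = S (Suc k)"
  have pq: "0 < p" "p < q" "q \<le> n"
    using p0 S_less_Suc[OF k] S_le[of "Suc k"] k by (auto simp: p_def q_def)
  have "0 < n" using pq by linarith
  obtain B where B: "V.basis B"
    and ev: "\<And>v. v \<in> B \<Longrightarrow> \<exists>\<mu>. eigenvector L v \<mu>"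
    and entries: "\<And>v i. v \<in> B \<Longrightarrow> i < n \<Longrightarrow> v $ i \<in> {-1, 0, 1}"
    using ss by (auto simp: simply_structured_def)
  have Bc: "B \<subseteq> carrier_vec n" and Bs: "V.span B = carrier_vec n"
    using B by (auto simp: V.basis_def)
  \<comment> \<open>The two values are chosen so that the entries sum to
    \<open>p * (q - p) - (q - p) * p = 0\<close>.\<close>
  define u where "u i = (if i < p then real (q - p) else if i < q then - real p else 0)" for i
  have sum_u: "(\<Sum>i<q. f i * u i) = real (q - p) * (\<Sum>i<p. f i) - real p * (\<Sum>i=p..<q. f i)" for f
  proof -
    have "(\<Sum>i<q. f i * u i) = (\<Sum>i<p. f i * u i) + (\<Sum>i=p..<q. f i * u i)"
      using pq sum.atLeastLessThan_concat[of 0 p q "\<lambda>i. f i * u i"]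
      by (simp add: atLeast0LessThan)
    also have "(\<Sum>i<p. f i * u i) = real (q - p) * (\<Sum>i<p. f i)"
      unfolding sum_distrib_left by (intro sum.cong) (auto simp: u_def)
    also have "(\<Sum>i=p..<q. f i * u i) = (\<Sum>i=p..<q. - real p * f i)"
      by (intro sum.cong) (auto simp: u_def)
    finally show ?thesis by (simp add: sum_distrib_left sum_negf)
  qed
  have u: "L *\<^sub>v vec n u = block_eigenvalue k \<cdot>\<^sub>v vec n u"
  proof (rule block_eigenvector[OF k])
    show "(\<Sum>i<S (Suc k). u i) = 0"
      using sum_u[of "\<lambda>_. 1"] pq by (simp add: q_def)
  qed (auto simp: u_def p_def[symmetric] q_def[symmetric] pq(2) not_less)
  \<comment> \<open>A vector orthogonal to the whole basis is orthogonal to every unit vector, but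
    \<open>u 0 = real (q - p)\<close> is positive.\<close>
  have "\<exists>v\<in>B. vec n u \<bullet> v \<noteq> 0"
  proof (rule ccontr)
    assume "\<not> ?thesis"
    then have "vec n u \<in> V.orthogonal_complement B" by (auto simp: V.orthogonal_complement_def)
    then have "vec n u \<in> V.orthogonal_complement (carrier_vec n)"
      using V.in_orthogonal_complement_span[OF Bc] Bs by simp
    then have "vec n u \<bullet> unit_vec n 0 = 0" by (auto simp: V.orthogonal_complement_def)
    then show False using pq \<open>0 < n\<close> by (simp add: u_def)
  qed
  then obtain v where v: "v \<in> B" "vec n u \<bullet> v \<noteq> 0" by blast
  then have vc: "v \<in> carrier_vec n" using Bc by auto
  obtain \<mu> where \<mu>: "L *\<^sub>v v = \<mu> \<cdot>\<^sub>v v" using ev[OF v(1)] by (auto simp: eigenvector_def)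
  note orth = eigenvectors_orthogonal[OF laplacian_carrier transpose_laplacian]
  have "\<mu> = block_eigenvalue k"
    using orth[OF _ u vc \<mu>] v(2) by fastforce
  note \<mu> = \<mu>[unfolded this]
  define F where "F j = (\<Sum>i<j. v $ i)" for j
  have F_Suc: "F (Suc j) = F j + v $ j" for j by (simp add: F_def)
  have F_n: "F n = 0"
    using orth[OF vc \<mu> _ const_eigenvector] block_eigenvalue_nonzero[OF k] vc
    by (simp add: scalar_prod_def F_def atLeast0LessThan)
  \<comment> \<open>Outside block \<open>k\<close> the test vector of position \<open>j\<close> has
    a different eigenvalue, hence is orthogonal to \<open>v\<close>.\<close>
  have F_eq: "F j = real j * v $ j" if j: "j < n" "j < p \<or> q \<le> j" for j
  proof -
    obtain l where l: "l < K" "S l \<le> j" "j < S (Suc l)" using ex_block[OF j(1)] .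
    then have "l \<noteq> k" using j by (auto simp: p_def q_def)
    then show ?thesis
      using orth[OF vc \<mu> _ position_eigenvector[OF l]] block_eigenvalue_inj[OF k l(1)]
        scalar_prod_position[OF j(1) vc] by (simp add: F_def)
  qed
  have const: "F j = real j * v $ 0" if "j \<le> p" for j
    using that
  proof (induction j)
    case 0
    then show ?case by (simp add: F_def)
  next
    case (Suc j)
    then have "real j * v $ j = real j * v $ 0" using F_eq[of j] pq by simp
    then have "v $ j = v $ 0" by (cases "j = 0") auto
    then show ?case using Suc by (simp add: F_Suc algebra_simps)
  qed
  \<comment> \<open>Descending from \<open>F n = 0\<close>: if \<open>F (Suc j) = 0\<close>, then
    \<open>F_eq\<close> gives \<open>(j + 1) * v $ j = 0\<close>, so \<open>F j = 0\<close>.\<close>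
  have F_0: "F j = 0" if "j \<le> n" "q \<le> j" for j
    using that
  proof (induction rule: inc_induct)
    case base
    show ?case by (rule F_n)
  next
    case (step j)
    then have "real j * v $ j + v $ j = 0" using F_Suc[of j] F_eq[of j] by simp
    then have "real (Suc j) * v $ j = 0" by (simp add: algebra_simps)
    then show ?case using F_eq[of j] step by simp
  qed
  have rest: "(\<Sum>i=p..<q. v $ i) = - F p"
    using F_0[of q] pq sum.atLeastLessThan_concat[of 0 p q "\<lambda>i. v $ i"]
    by (simp add: F_def atLeast0LessThan)
  have "vec n u \<bullet> v = (\<Sum>i<n. v $ i * u i)"
    using vc by (simp add: scalar_prod_def atLeast0LessThan mult.commute)
  also have "\<dots> = (\<Sum>i<q. v $ i * u i)"
    using pq by (intro sum.mono_neutral_right) (auto simp: u_def)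
  also have "\<dots> = real q * F p"
    unfolding sum_u rest using pq by (simp add: F_def[symmetric] of_nat_diff algebra_simps)
  finally have "v $ 0 \<noteq> 0" using v(2) const[of p] by auto
  \<comment> \<open>The first \<open>p\<close> entries of \<open>v\<close> are now all 1 or all -1,
    so the \<open>q - p\<close> entries of the block must balance a sum of absolute value
    \<open>p\<close>.\<close>
  then have "\<bar>v $ 0\<bar> = 1" using entries[OF v(1) \<open>0 < n\<close>] by auto
  then have "real p = \<bar>F p\<bar>" using const[of p] by (simp add: abs_mult)
  also have "\<dots> = \<bar>\<Sum>i=p..<q. v $ i\<bar>" using rest by simp
  also have "\<dots> \<le> (\<Sum>i=p..<q. \<bar>v $ i\<bar>)" by (rule sum_abs)
  also have "\<dots> \<le> (\<Sum>i=p..<q. 1)"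
  proof (rule sum_mono)
    fix i assume "i \<in> {p..<q}"
    then show "\<bar>v $ i\<bar> \<le> 1" using entries[OF v(1), of i] pq by auto
  qed
  finally have "p \<le> q - p" by simp
  then show ?thesis using pq by (simp add: p_def q_def)
qed simp

section \<open>Doubling implies simply structured\<close>

definition simple_eigenvectors :: "real vec set" where
  "simple_eigenvectors =
    {v. (\<exists>\<mu>. eigenvector L v \<mu>) \<and> (\<forall>i<n. v $ i \<in> {-1, 0, 1})}"

lemma simple_eigenvectors_carrier: "simple_eigenvectors \<subseteq> carrier_vec n"
  by (auto simp: simple_eigenvectors_def eigenvector_def)

text \<open>Finiteness allows a minimal spanning subset, hence a basis, to be extracted once the set
  is known to span.\<close>

lemma finite_simple_eigenvectors: "finite simple_eigenvectors"
proof (rule finite_subset)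
  show "finite ((\<lambda>f. vec n f) ` ({..<n} \<rightarrow>\<^sub>E {-1, 0, 1 :: real}))"
    by (intro finite_imageI finite_PiE) auto
  show "simple_eigenvectors \<subseteq> (\<lambda>f. vec n f) ` ({..<n} \<rightarrow>\<^sub>E {-1, 0, 1 :: real})"
  proof
    fix v assume v: "v \<in> simple_eigenvectors"
    then have "v = vec n (restrict (($) v) {..<n})"
      using simple_eigenvectors_carrier by (intro eq_vecI) auto
    moreover have "restrict (($) v) {..<n} \<in> {..<n} \<rightarrow>\<^sub>E {-1, 0, 1}"
      using v by (auto simp: simple_eigenvectors_def)
    ultimately show "v \<in> (\<lambda>f. vec n f) ` ({..<n} \<rightarrow>\<^sub>E {-1, 0, 1})" by blast
  qed
qed

text \<open>For \<open>p = S k\<close> and \<open>q = S (Suc k)\<close>, the \<open>k\<close>-th eigenspace contains the differences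
  \<open>e\<^sub>l - e\<^sub>i\<close> of unit vectors of the block and \<open>1\<^bsub>{..<p}\<^esub> - 1\<^bsub>{p..<2p}\<^esub>\<close>. Modulo these,
  \<open>1\<^bsub>{..<q}\<^esub>\<close> is \<open>q e\<^sub>i\<close>. Hence the span of all of them and the all-ones vector
  contains every unit vector, by descending induction on the blocks.\<close>

lemma simply_structured_if_doubling:
  assumes doubling: "\<And>k. k < K \<Longrightarrow> 2 * S k \<le> S (Suc k)"
  shows "simply_structured n (threshold_edges b)"
proof -
  interpret V: vec_space "TYPE(real)" n .
  note Gc = simple_eigenvectors_carrier
  define P where "P f \<longleftrightarrow> vec n f \<in> V.span simple_eigenvectors" for f
  \<comment> \<open>The zero vector is no eigenvector but lies in the span. It does occur below: as
    \<open>e i - e i\<close>, and in \<open>half\<close> when \<open>S k = 0\<close>.\<close>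
  have P_eigen: "P x" if "L *\<^sub>v vec n x = \<mu> \<cdot>\<^sub>v vec n x" "\<And>i. x i \<in> {-1, 0, 1}" for x \<mu>
  proof (cases "vec n x = 0\<^sub>v n")
    case True
    then show ?thesis using V.span_zero by (simp add: P_def)
  next
    case False
    then have "vec n x \<in> simple_eigenvectors"
      using that by (auto simp: simple_eigenvectors_def eigenvector_def)
    then show ?thesis using V.in_own_span[OF Gc] by (auto simp: P_def)
  qed
  have P_0: "P (\<lambda>_. 0)"
    using P_eigen[of "\<lambda>_. 0" 0] by (simp add: P_def zero_vec_def[symmetric] V.span_zero)
  have P_add: "P (\<lambda>i. f i + g i)" if "P f" "P g" for f g
  proof -
    have "vec n (\<lambda>i. f i + g i) = vec n f + vec n g" by (rule eq_vecI) auto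
    then show ?thesis using V.span_add1 Gc that by (simp add: P_def)
  qed
  have P_smult: "P (\<lambda>i. c * f i)" if "P f" for c f
  proof -
    have "vec n (\<lambda>i. c * f i) = c \<cdot>\<^sub>v vec n f" by (rule eq_vecI) auto
    then show ?thesis using V.smult_in_span Gc that by (simp add: P_def)
  qed
  have P_diff: "P (\<lambda>i. f i - g i)" if "P f" "P g" for f g
    using P_add[OF that(1) P_smult[OF that(2), of "-1"]] by simp
  have P_sum: "P (\<lambda>i. \<Sum>l\<in>A. f l i)" if "finite A" "\<And>l. l \<in> A \<Longrightarrow> P (f l)" for A and f :: "nat \<Rightarrow> _"
    using that by (induction A rule: finite_induct) (auto intro: P_0 P_add)
  define e :: "nat \<Rightarrow> nat \<Rightarrow> real" where "e i j = (if j = i then 1 else 0)" for i j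
  define ind :: "nat \<Rightarrow> nat \<Rightarrow> real" where "ind m j = (if j < m then 1 else 0)" for m j
  have sum_e: "(\<Sum>l=p..<r. e l j - e i j) = ind r j - ind p j - real (r - p) * e i j"
    if "p \<le> r" for p r i j
    using that by (auto simp: e_def ind_def sum_subtractf)
  \<comment> \<open>One step of the descent: from the indicator of everything up to the end of block
    \<open>k\<close> to that of everything before it, collecting the unit vectors of the
    block.\<close>
  have block: "P (ind (S k)) \<and> (\<forall>i. S k \<le> i \<and> i < S (Suc k) \<longrightarrow> P (e i))"
    if k: "k < K" and ind: "P (ind (S (Suc k)))" for k
  proof -
    let ?p = "S k" and ?q = "S (Suc k)"
    have pq: "?p < ?q" "2 * ?p \<le> ?q" using S_less_Suc[OF k] doubling[OF k] by auto
    have diff: "P (\<lambda>j. e l j - e i j)" if "l \<in> {?p..<?q}" "i \<in> {?p..<?q}" for l i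
    proof (rule P_eigen[OF block_eigenvector[OF k]])
      have "(\<Sum>j<?q. e l j - e i j) = (\<Sum>j<?q. if j = l then 1 else 0) - (\<Sum>j<?q. if j = i then 1 else 0)"
        by (simp add: e_def sum_subtractf)
      then show "(\<Sum>j<?q. e l j - e i j) = 0" using that by simp
    qed (use that in \<open>auto simp: e_def\<close>)
    \<comment> \<open>The entries are 1 below \<open>?p\<close>, -1 from there up to
      \<open>2 * ?p\<close>, and 0 afterwards. Doubling ensures that the -1 entries fit into the
      block.\<close>
    have half: "P (\<lambda>j. ind ?p j + ind ?p j - ind (2 * ?p) j)"
    proof (rule P_eigen[OF block_eigenvector[OF k]])
      have "(\<Sum>j<?q. ind m j) = real m" if "m \<le> ?q" for m
      proof -
        have "(\<Sum>j<?q. ind m j) = (\<Sum>j<m. ind m j)"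
          using that by (intro sum.mono_neutral_right) (auto simp: ind_def)
        then show ?thesis by (simp add: ind_def)
      qed
      then show "(\<Sum>j<?q. ind ?p j + ind ?p j - ind (2 * ?p) j) = 0"
        using pq by (simp only: sum_subtractf sum.distrib)
    qed (use pq in \<open>auto simp: ind_def\<close>)
    have key: "P (e i) \<and> P (ind ?p)" if i: "i \<in> {?p..<?q}" for i
    proof -
      have "P (\<lambda>j. \<Sum>l=?p..<2 * ?p. e l j - e i j)"
        using pq i by (intro P_sum diff) auto
      then have "P (\<lambda>j. ind (2 * ?p) j - ind ?p j - real ?p * e i j)"
        using sum_e[of ?p "2 * ?p"] by simp
      from P_add[OF half this] have 1: "P (\<lambda>j. ind ?p j - real ?p * e i j)"
        by (simp add: algebra_simps)
      have "P (\<lambda>j. \<Sum>l=?p..<?q. e l j - e i j)"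
        using pq i by (intro P_sum diff) auto
      then have "P (\<lambda>j. ind ?q j - ind ?p j - real (?q - ?p) * e i j)"
        using sum_e[of ?p ?q] pq by simp
      from P_diff[OF ind this] have "P (\<lambda>j. ind ?p j + real (?q - ?p) * e i j)"
        by (simp add: algebra_simps)
      \<comment> \<open>Subtracting \<open>ind ?p - ?p * e i\<close> from
        \<open>ind ?p + (?q - ?p) * e i\<close> leaves \<open>?q * e i\<close>.\<close>
      from P_diff[OF this 1] have "P (\<lambda>j. real ?q * e i j)"
        using pq by (simp add: algebra_simps of_nat_diff)
      from P_smult[OF this, of "1 / real ?q"] have ei: "P (e i)"
        using pq by (simp add: eta_contract_eq)
      from P_add[OF 1 P_smult[OF this, of "real ?p"]] have "P (ind ?p)" by simp
      with ei show ?thesis by simp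
    qed
    then show ?thesis using pq by auto
  qed
  have "P (\<lambda>_. 1)" using P_eigen[OF const_eigenvector] by simp
  moreover have "vec n (\<lambda>_. 1) = vec n (ind (S K))" by (rule eq_vecI) (auto simp: ind_def S_K)
  ultimately have P_ind_K: "P (ind (S K))" by (simp add: P_def)
  have P_ind: "P (ind (S k))" if "k \<le> K" for k
    using that by (induction rule: inc_induct) (use P_ind_K block in auto)
  have P_e: "P (e i)" if "i < n" for i
    using ex_block[OF that] block P_ind by (metis Suc_leI)
  have "V.span simple_eigenvectors = carrier_vec n"
  proof
    show "V.span simple_eigenvectors \<subseteq> carrier_vec n" using V.span_closed Gc by auto
    show "carrier_vec n \<subseteq> V.span simple_eigenvectors"
    proof
      fix v :: "real vec" assume v: "v \<in> carrier_vec n"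
      have "P (\<lambda>j. \<Sum>i<n. v $ i * e i j)" by (intro P_sum P_smult P_e) auto
      moreover have "vec n (\<lambda>j. \<Sum>i<n. v $ i * e i j) = v"
        using v by (intro eq_vecI) (auto simp: e_def if_distrib cong: if_cong)
      ultimately show "v \<in> V.span simple_eigenvectors" by (simp add: P_def)
    qed
  qed
  then obtain B where B: "B \<subseteq> simple_eigenvectors"
    "minimal B (\<lambda>A. A \<subseteq> carrier_vec n \<and> V.span A = carrier_vec n)"
    using minimal_exists[OF finite_simple_eigenvectors,
        of "\<lambda>A. A \<subseteq> carrier_vec n \<and> V.span A = carrier_vec n"] Gc by auto
  have "V.basis B" by (rule V.min_gen_is_basis[OF B(2)])
  then show ?thesis using B(1) unfolding simply_structured_def simple_eigenvectors_def by blast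
qed

lemma simply_structured_iff_doubling:
  "simply_structured n (threshold_edges b) \<longleftrightarrow> (\<forall>k<K. 2 * S k \<le> S (Suc k))"
  using doubling_if_simply_structured simply_structured_if_doubling by blast

end

section \<open>Block sequences\<close>

text \<open>Zeros and ones are numbered jointly from 0: for \<open>i \<ge> 1\<close>, block
  \<open>2 * i - 2\<close> is the run of \<open>s i\<close> zeros and block \<open>2 * i - 1\<close>
  the run of \<open>t i\<close> ones.\<close>

definition block_start :: "(nat \<Rightarrow> nat) \<Rightarrow> (nat \<Rightarrow> nat) \<Rightarrow> nat \<Rightarrow> nat" where
  "block_start s t k =
    (\<Sum>j=1..k div 2. s j + t j) + (if odd k then s (Suc (k div 2)) else 0)"

lemma block_start_double: "block_start s t (2 * r) = (\<Sum>j=1..r. s j + t j)"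
  by (simp add: block_start_def)

lemma block_start_Suc:
  "block_start s t (Suc k) = block_start s t k + (if even k then s else t) (Suc (k div 2))"
  by (auto simp: block_start_def elim!: evenE oddE)

lemma block_sequence_Suc:
  "block_sequence (Suc r) s t =
    block_sequence r s t @ replicate (s (Suc r)) False @ replicate (t (Suc r)) True"
  by (simp add: block_sequence_def)

lemma length_block_sequence: "length (block_sequence r s t) = block_start s t (2 * r)"
proof (induction r)
  case 0
  then show ?case by (simp add: block_sequence_def block_start_def)
next
  case (Suc r)
  then show ?case
    using block_start_Suc[of s t "2 * r"] block_start_Suc[of s t "Suc (2 * r)"]
    by (simp add: block_sequence_Suc)
qed

lemma block_sequence_nth:
  assumes "k < 2 * r" "block_start s t k \<le> i" "i < block_start s t (Suc k)"
  shows "block_sequence r s t ! i \<longleftrightarrow> odd k"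
  using assms
proof (induction r)
  case (Suc r)
  have mono: "block_start s t k \<le> block_start s t l" if "k \<le> l" for k l
    using that by (induction rule: dec_induct) (auto simp: block_start_Suc)
  have "k < 2 * r \<or> k = 2 * r \<or> k = Suc (2 * r)" using Suc.prems(1) by auto
  then consider "k < 2 * r" | "k = 2 * r" | "k = Suc (2 * r)" by blast
  then show ?case
  proof cases
    case 1
    then have "i < block_start s t (2 * r)" using Suc.prems mono[of "Suc k" "2 * r"] by simp
    then show ?thesis
      using 1 Suc by (simp add: block_sequence_Suc nth_append length_block_sequence)
  next
    case 2
    then show ?thesis
      using Suc.prems
      by (simp add: block_sequence_Suc nth_append length_block_sequence block_start_Suc)
  next
    case 3
    then show ?thesis
      using Suc.prems
      by (auto simp: block_sequence_Suc nth_append length_block_sequence block_start_Suc)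
  qed
qed simp

section \<open>Arithmetic of the ceilings, powers and logarithms\<close>

lemma half_ceiling_le_iff: "\<lceil>real a / 2\<rceil> \<le> int c \<longleftrightarrow> a \<le> 2 * c"
  by (simp add: ceiling_le_iff) linarith

lemma power_le_of_doubling:
  fixes S :: "nat \<Rightarrow> nat"
  assumes "0 < S 1" "\<And>k. 0 < k \<Longrightarrow> k < K \<Longrightarrow> 2 * S k \<le> S (Suc k)" "k < K"
  shows "2 ^ k \<le> S (Suc k)"
  using assms(3)
proof (induction k)
  case (Suc k)
  then show ?case using assms(2)[of "Suc k"] by simp
qed (use assms(1) in simp)

text \<open>The integer \<open>2 * r - 1\<close> is at most \<open>log 2 n\<close>, hence at most
  its floor; adding 1 and halving gives \<open>r\<close>.\<close>

lemma half_floor_log_bound: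
  assumes "0 < r" "2 ^ (2 * r - 1) \<le> n"
  shows "int r \<le> \<lfloor>(real_of_int \<lfloor>log 2 (real n)\<rfloor> + 1) / 2\<rfloor>"
proof -
  have "(2::nat) ^ (2 * r - 1) > 0" by simp
  then have "0 < n" using assms(2) by linarith
  have "(2::real) ^ (2 * r - 1) \<le> real n" using assms(2) by (metis of_nat_le_iff of_nat_numeral of_nat_power)
  then have "real (2 * r - 1) \<le> log 2 (real n)"
    using \<open>0 < n\<close> by (simp add: le_log_iff powr_realpow)
  then have "int (2 * r - 1) \<le> \<lfloor>log 2 (real n)\<rfloor>" by (simp add: le_floor_iff)
  then have "2 * real r - 1 \<le> real_of_int \<lfloor>log 2 (real n)\<rfloor>" using assms(1) by linarith
  then show ?thesis by (simp add: le_floor_iff)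
qed

theorem theorem3p5:
  fixes n r :: nat and s t :: "nat \<Rightarrow> nat" and b :: "bool list"
  assumes "threshold_sequence b"
    and "b = block_sequence r s t"
    and "\<And>j. j \<in> {1..r} \<Longrightarrow> 0 < s j \<and> 0 < t j"
    and "(\<Sum>j=1..r. s j + t j) = n"
  shows "simply_structured n (threshold_edges b) \<longleftrightarrow>
      (1 \<le> r \<and> int r \<le> \<lfloor>(real_of_int \<lfloor>log 2 (real n)\<rfloor> + 1) / 2\<rfloor>)
    \<and> (\<forall>i\<in>{1..r}.
          \<lceil>(real n - real (\<Sum>j=i+1..r. s j + t j)) / 2\<rceil> \<le> int (t i)
        \<and> int (t i) \<le> int n - int (\<Sum>j=i+1..r. s j + t j) - 2 ^ (2 * i - 2))
    \<and> (\<forall>i\<in>{2..r}.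
          \<lceil>(real n - real (t i) - real (\<Sum>j=i+1..r. s j + t j)) / 2\<rceil> \<le> int (s i)
        \<and> int (s i) \<le> int n - int (t i) - int (\<Sum>j=i+1..r. s j + t j) - 2 ^ (2 * i - 3))
    \<and> int (s 1) = int n - int (t 1) - int (\<Sum>j=2..r. s j + t j)"
proof -
  let ?S = "block_start s t"
  have "r \<noteq> 0" using assms(1,2) by (auto simp: threshold_sequence_def block_sequence_def)
  then have r: "1 \<le> r" by simp
  have pos: "0 < (if even k then s else t) (Suc (k div 2))" if "k < 2 * r" for k
    using assms(3)[of "Suc (k div 2)"] that by auto
  have len: "length b = n"
    using assms(2,4) by (simp add: length_block_sequence block_start_double)
  interpret alternating_blocks b ?S "2 * r"
  proof
    show "?S k < ?S (Suc k)" if "k < 2 * r" for k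
      using pos[OF that] by (simp add: block_start_Suc)
    show "?S (2 * r) = length b" by (simp add: assms(2) length_block_sequence)
    show "b ! i \<longleftrightarrow> odd k" if "k < 2 * r" "?S k \<le> i" "i < ?S (Suc k)" for k i
      unfolding assms(2) using that by (rule block_sequence_nth)
  qed (simp_all add: block_start_def)
  \<comment> \<open>Thus \<open>n\<close> minus the tail sum counts the vertices up to the end of
    the \<open>i\<close>-th run of ones.\<close>
  have tail: "?S (2 * i) + (\<Sum>j=i+1..r. s j + t j) = n" if "i \<le> r" for i
  proof -
    have "{1..r} = {1..i} \<union> {i+1..r}" using that by auto
    then show ?thesis
      unfolding block_start_double assms(4)[symmetric]
      by (simp only:) (subst sum.union_disjoint; auto)
  qed
  have even: "?S (2 * i) = ?S (2 * i - 1) + t i" if "1 \<le> i" for i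
    using that block_start_Suc[of s t "2 * i - 1"] by (cases i) auto
  have odd: "?S (2 * i - 1) = ?S (2 * i - 2) + s i" if "1 \<le> i" for i
    using that block_start_Suc[of s t "2 * i - 2"] by (cases i) auto
  \<comment> \<open>Since \<open>?S (2 * i) = ?S (2 * i - 1) + t i\<close>, doubling at block
    \<open>2 * i - 1\<close> says exactly \<open>?S (2 * i) \<le> 2 * t i\<close>; likewise for
    \<open>s i\<close>. The range of \<open>S_low\<close> starts at 2 because doubling at block 0 is
    trivial.\<close>
  define T_low where "T_low \<longleftrightarrow> (\<forall>i\<in>{1..r}. ?S (2 * i) \<le> 2 * t i)"
  define S_low where "S_low \<longleftrightarrow> (\<forall>i\<in>{2..r}. ?S (2 * i - 1) \<le> 2 * s i)"
  have doubling: "(\<forall>k<2 * r. 2 * ?S k \<le> ?S (Suc k)) \<longleftrightarrow> T_low \<and> S_low"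
  proof (intro iffI conjI allI impI)
    assume *: "\<forall>k<2 * r. 2 * ?S k \<le> ?S (Suc k)"
    show T_low unfolding T_low_def
    proof
      fix i assume i: "i \<in> {1..r}"
      then have "2 * i - 1 < 2 * r" "Suc (2 * i - 1) = 2 * i"
        unfolding atLeastAtMost_iff by linarith+
      then show "?S (2 * i) \<le> 2 * t i"
        using i *[rule_format, of "2 * i - 1"] even[of i] by simp
    qed
    show S_low unfolding S_low_def
    proof
      fix i assume i: "i \<in> {2..r}"
      then have "2 * i - 2 < 2 * r" "Suc (2 * i - 2) = 2 * i - 1"
        unfolding atLeastAtMost_iff by linarith+
      then show "?S (2 * i - 1) \<le> 2 * s i"
        using i *[rule_format, of "2 * i - 2"] odd[of i] by simp
    qed
  next
    fix k assume *: "T_low \<and> S_low" and k: "k < 2 * r"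
    show "2 * ?S k \<le> ?S (Suc k)"
    proof (cases "even k")
      case True
      then obtain i where i: "k = 2 * i" by blast
      have "?S (2 * Suc i - 1) \<le> 2 * s (Suc i)" if "i \<noteq> 0"
      proof -
        have "Suc i \<in> {2..r}" using i k that by auto
        then show ?thesis using * unfolding S_low_def by blast
      qed
      then show ?thesis using i odd[of "Suc i"] by (cases "i = 0") auto
    next
      case False
      then obtain i where i: "k = 2 * i + 1" by (blast elim: oddE)
      then have "Suc i \<in> {1..r}" using k by auto
      then have "?S (2 * Suc i) \<le> 2 * t (Suc i)" using * unfolding T_low_def by blast
      then show ?thesis using i even[of "Suc i"] by auto
    qed
  qed
  \<comment> \<open>The lower bound on \<open>t i\<close> is doubling at its block; the upper bound
    is a lower bound on the number of vertices before that block.\<close>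
  have t_cond: "\<lceil>(real n - real (\<Sum>j=i+1..r. s j + t j)) / 2\<rceil> \<le> int (t i) \<longleftrightarrow>
      ?S (2 * i) \<le> 2 * t i"
    "int (t i) \<le> int n - int (\<Sum>j=i+1..r. s j + t j) - 2 ^ (2 * i - 2) \<longleftrightarrow>
      2 ^ (2 * i - 2) \<le> ?S (2 * i - 1)" if "i \<in> {1..r}" for i
  proof -
    have eq: "real n - real (\<Sum>j=i+1..r. s j + t j) = real (?S (2 * i))"
      "int n - int (\<Sum>j=i+1..r. s j + t j) = int (?S (2 * i - 1)) + int (t i)"
      using tail[of i] even[of i] that by auto
    show "\<lceil>(real n - real (\<Sum>j=i+1..r. s j + t j)) / 2\<rceil> \<le> int (t i) \<longleftrightarrow> ?S (2 * i) \<le> 2 * t i"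
      unfolding eq by (rule half_ceiling_le_iff)
    have "(2::nat) ^ (2 * i - 2) \<le> ?S (2 * i - 1) \<longleftrightarrow> 2 ^ (2 * i - 2) \<le> int (?S (2 * i - 1))"
      by (metis of_nat_le_iff of_nat_numeral of_nat_power)
    then show "int (t i) \<le> int n - int (\<Sum>j=i+1..r. s j + t j) - 2 ^ (2 * i - 2) \<longleftrightarrow>
      2 ^ (2 * i - 2) \<le> ?S (2 * i - 1)"
      unfolding eq by linarith
  qed
  have s_cond: "\<lceil>(real n - real (t i) - real (\<Sum>j=i+1..r. s j + t j)) / 2\<rceil> \<le> int (s i) \<longleftrightarrow>
      ?S (2 * i - 1) \<le> 2 * s i"
    "int (s i) \<le> int n - int (t i) - int (\<Sum>j=i+1..r. s j + t j) - 2 ^ (2 * i - 3) \<longleftrightarrow>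
      2 ^ (2 * i - 3) \<le> ?S (2 * i - 2)" if "i \<in> {2..r}" for i
  proof -
    have eq: "real n - real (t i) - real (\<Sum>j=i+1..r. s j + t j) = real (?S (2 * i - 1))"
      "int n - int (t i) - int (\<Sum>j=i+1..r. s j + t j) = int (?S (2 * i - 2)) + int (s i)"
      using tail[of i] even[of i] odd[of i] that by auto
    show "\<lceil>(real n - real (t i) - real (\<Sum>j=i+1..r. s j + t j)) / 2\<rceil> \<le> int (s i) \<longleftrightarrow>
      ?S (2 * i - 1) \<le> 2 * s i"
      unfolding eq by (rule half_ceiling_le_iff)
    have "(2::nat) ^ (2 * i - 3) \<le> ?S (2 * i - 2) \<longleftrightarrow> 2 ^ (2 * i - 3) \<le> int (?S (2 * i - 2))"
      by (metis of_nat_le_iff of_nat_numeral of_nat_power)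
    then show "int (s i) \<le> int n - int (t i) - int (\<Sum>j=i+1..r. s j + t j) - 2 ^ (2 * i - 3) \<longleftrightarrow>
      2 ^ (2 * i - 3) \<le> ?S (2 * i - 2)"
      unfolding eq by linarith
  qed
  have s_1: "int (s 1) = int n - int (t 1) - int (\<Sum>j=2..r. s j + t j)"
  proof -
    have "n = s 1 + t 1 + (\<Sum>j=2..r. s j + t j)"
      using tail[of 1] r even[of 1] odd[of 1] by (simp add: numeral_2_eq_2)
    then show ?thesis by (simp only: of_nat_add)
  qed
  have ss: "simply_structured n (threshold_edges b) \<longleftrightarrow> T_low \<and> S_low"
    using simply_structured_iff_doubling len doubling by simp
  have power: "2 ^ k \<le> ?S (Suc k)" if "T_low \<and> S_low" "k < 2 * r" for k
  proof (rule power_le_of_doubling[OF _ _ that(2)])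
    show "0 < ?S 1" using S_less_Suc[of 0] r by simp
  qed (use that(1) doubling in blast)
  have upper: "2 ^ (2 * i - 2) \<le> ?S (2 * i - 1)" if "T_low \<and> S_low" "i \<in> {1..r}" for i
    using power[OF that(1), of "2 * i - 2"] that(2) by (cases i) auto
  have upper': "2 ^ (2 * i - 3) \<le> ?S (2 * i - 2)" if "T_low \<and> S_low" "i \<in> {2..r}" for i
  proof -
    have "Suc (2 * i - 3) = 2 * i - 2" "2 * i - 3 < 2 * r"
      using that(2) unfolding atLeastAtMost_iff by linarith+
    then show ?thesis using power[OF that(1), of "2 * i - 3"] by simp
  qed
  \<comment> \<open>All \<open>2 * r\<close> blocks together give \<open>n = ?S (2 * r)\<close>,
    which is at least \<open>2 ^ (2 * r - 1)\<close>.\<close>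
  have log: "int r \<le> \<lfloor>(real_of_int \<lfloor>log 2 (real n)\<rfloor> + 1) / 2\<rfloor>" if "T_low \<and> S_low"
  proof (rule half_floor_log_bound)
    have "Suc (2 * r - 1) = 2 * r" using r by simp
    then show "2 ^ (2 * r - 1) \<le> n"
      using power[OF that, of "2 * r - 1"] r S_K len by simp
  qed (use r in simp)
  \<comment> \<open>The lower bounds amount to \<open>T_low \<and> S_low\<close>, which implies the
    upper bounds and the bound on \<open>r\<close>; the equation for \<open>s 1\<close> always
    holds.\<close>
  show ?thesis
    unfolding ss
    using r s_1 t_cond s_cond upper upper' log unfolding T_low_def S_low_def by (smt (verit))
qed

end
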